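(* Let $3\le m\le n$ be integers and let $T_{m,n}=C_m\Box C_n$. Then $\chi(T_{m,n}^2)\le 7$, except that $\chi(T_{3,3}^2)=9$ and $\chi(T_{3,5}^2)=\chi(T_{4,4}^2)=8$.
   Context: $C_k$ denotes the cycle on $k$ vertices. The Cartesian product $G\Box H$ has vertex set $V(G)\times V(H)$, with $(u_1,v_1)$ adjacent to $(u_2,v_2)$ iff either $u_1=u_2$ and $v_1v_2\in E(H)$, or $v_1=v_2$ and $u_1u_2\in E(G)$. The square $G^2$ of a graph $G$ has the same vertex set as $G$, and two distinct vertices are adjacent in $G^2$ iff their distance in $G$ is at most 2. $\chi$ denotes the chromatic number. *)

theory Defs
  imports "Graph_Theory.Graph_Theory"
begin

text \<open>
  A finite simple undirected graph is a \<^locale>\<open>pair_graph\<close>: a finite, loop-free, symmetric digraph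
  without parallel arcs, an edge \<open>uv\<close> being the pair of arcs \<open>(u, v)\<close>, \<open>(v, u)\<close>.
\<close>

text \<open>Intended for \<open>k \<ge> 3\<close> only; for \<open>k = 1\<close> the formula gives a loop.\<close>

definition cycle_graph :: "nat \<Rightarrow> nat pair_pre_digraph" where
  "cycle_graph k =
    \<lparr> pverts = {..<k},
      parcs = {(i, j). i < k \<and> j < k \<and> (j = (i + 1) mod k \<or> i = (j + 1) mod k)} \<rparr>"

definition cart_prod :: "'a pair_pre_digraph \<Rightarrow> 'b pair_pre_digraph \<Rightarrow> ('a \<times> 'b) pair_pre_digraph"
    (infixr \<open>\<box>\<close> 80) where
  "G \<box> H =
    \<lparr> pverts = pverts G \<times> pverts H,
      parcs = {((u1, v1), (u2, v2)).
        u1 \<in> pverts G \<and> u2 \<in> pverts G \<and> v1 \<in> pverts H \<and> v2 \<in> pverts H \<and>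
        (u1 = u2 \<and> (v1, v2) \<in> parcs H \<or> v1 = v2 \<and> (u1, u2) \<in> parcs G)} \<rparr>"

text \<open>
  The distance is the least number of arcs on a walk, i.e. the shortest-path weight for unit
  weights. It is \<open>\<infinity>\<close> if there is no walk.
\<close>

definition graph_dist :: "'a pair_pre_digraph \<Rightarrow> 'a \<Rightarrow> 'a \<Rightarrow> ereal" where
  "graph_dist G u v = wf_digraph.\<mu> (with_proj G) (\<lambda>_. 1) u v"

definition graph_square :: "'a pair_pre_digraph \<Rightarrow> 'a pair_pre_digraph" where
  "graph_square G =
    \<lparr> pverts = pverts G,
      parcs = {(u, v). u \<in> pverts G \<and> v \<in> pverts G \<and> u \<noteq> v \<and> graph_dist G u v \<le> 2} \<rparr>"

definition proper_colouring :: "'a pair_pre_digraph \<Rightarrow> nat \<Rightarrow> ('a \<Rightarrow> nat) \<Rightarrow> bool" where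
  "proper_colouring G k c \<longleftrightarrow>
    (\<forall>v \<in> pverts G. c v < k) \<and> (\<forall>(u, v) \<in> parcs G. c u \<noteq> c v)"

text \<open>
  The minimum exists for every finite loop-free graph, see \<open>ex_proper_colouring\<close> below. Otherwise
  the value may be meaningless.
\<close>

definition chromatic_number :: "'a pair_pre_digraph \<Rightarrow> nat" where
  "chromatic_number G = (LEAST k. \<exists>c. proper_colouring G k c)"

definition torus_graph :: "nat \<Rightarrow> nat \<Rightarrow> (nat \<times> nat) pair_pre_digraph" where
  "torus_graph m n = cycle_graph m \<box> cycle_graph n"

lemma (in pair_digraph) ex_proper_colouring: "\<exists>c. proper_colouring G (card (pverts G)) c"
proof -
  obtain c :: "'a \<Rightarrow> nat" where c: "bij_betw c (pverts G) {0..<card (pverts G)}"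
    using ex_bij_betw_finite_nat pair_finite_verts by blast
  have "c v < card (pverts G)" if "v \<in> pverts G" for v
    using bij_betwE[OF c] that by auto
  moreover have "c u \<noteq> c v" if "(u, v) \<in> parcs G" for u v
    using that pair_no_loops[OF that] in_arcsD1[OF that] in_arcsD2[OF that] c
    by (auto simp: bij_betw_def inj_on_def)
  ultimately show ?thesis
    unfolding proper_colouring_def by blast
qed

lemma pair_graph_cycle_graph:
  assumes "k \<ge> 3"
  shows "pair_graph (cycle_graph k)"
proof
  show "finite (parcs (cycle_graph k))"
    by (rule finite_subset[of _ "{..<k} \<times> {..<k}"]) (auto simp: cycle_graph_def)
  fix e assume "e \<in> parcs (cycle_graph k)"
  then show "fst e \<noteq> snd e"
    using assms by (auto simp: cycle_graph_def mod_Suc split: if_splits)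
qed (use assms in \<open>auto simp: cycle_graph_def symmetric_def sym_def\<close>)

lemma pair_graph_cart_prod:
  assumes "pair_graph G" "pair_graph H"
  shows "pair_graph (G \<box> H)"
proof -
  interpret G: pair_graph G by fact
  interpret H: pair_graph H by fact
  have "sym (parcs G)" "sym (parcs H)"
    using G.pair_sym_arcs H.pair_sym_arcs by (auto simp: symmetric_def)
  note sym = this[THEN symD]
  show ?thesis
  proof
    show "finite (parcs (G \<box> H))"
      by (rule finite_subset[of _ "(pverts G \<times> pverts H) \<times> (pverts G \<times> pverts H)"])
        (auto simp: cart_prod_def)
    fix e assume "e \<in> parcs (G \<box> H)"
    then show "fst e \<noteq> snd e"
      by (auto simp: cart_prod_def dest: G.pair_no_loops H.pair_no_loops)
  qed (auto simp: cart_prod_def symmetric_def sym_def intro: sym)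
qed

lemma pair_graph_torus_graph:
  assumes "m \<ge> 3" "n \<ge> 3"
  shows "pair_graph (torus_graph m n)"
  unfolding torus_graph_def
  using assms by (intro pair_graph_cart_prod pair_graph_cycle_graph)

lemma (in pair_graph) graph_dist_le_2_iff:
  assumes "u \<in> pverts G" "v \<in> pverts G"
  shows "graph_dist G u v \<le> 2 \<longleftrightarrow>
    u = v \<or> (u, v) \<in> parcs G \<or> (\<exists>w. (u, w) \<in> parcs G \<and> (w, v) \<in> parcs G)"
  (is "?L \<longleftrightarrow> ?R")
proof
  have cost: "awalk_cost (\<lambda>_. 1) p = real (length p)" for p :: "('a \<times> 'a) list"
    by (induction p) auto
  {
    assume ?L
    then have "\<mu> (\<lambda>_. 1) u v < 3"
      unfolding graph_dist_def by (rule le_less_trans) simp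
    then obtain p where p: "awalk u p v" "ereal (awalk_cost (\<lambda>_. 1) p) < 3"
      unfolding \<mu>_def by (auto simp: INF_less_iff)
    then have "length p < 3"
      by (simp add: cost)
    then consider "p = []" | a where "p = [a]" | a b where "p = [a, b]"
      by (auto simp: less_Suc_eq numeral_3_eq_3 length_Suc_conv)
    then show ?R
      using p(1) by cases (auto simp: awalk_def)
  next
    have le: "graph_dist G u v \<le> 2" if "awalk u p v" "length p \<le> 2" for p
    proof -
      have "graph_dist G u v \<le> ereal (awalk_cost (\<lambda>_. 1) p)"
        unfolding graph_dist_def by (rule min_cost_le_walk_cost) fact
      also have "\<dots> \<le> 2"
        using that(2) by (simp add: cost)
      finally show ?thesis .
    qed
    assume ?R
    then consider "u = v" | "(u, v) \<in> parcs G" | w where "(u, w) \<in> parcs G" "(w, v) \<in> parcs G"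
      by blast
    then show ?L
    proof cases
      case 1
      then show ?thesis using le[of "[]"] assms by (simp add: awalk_def)
    next
      case 2
      then show ?thesis using le[of "[(u, v)]"] assms by (simp add: awalk_def)
    next
      case 3
      then show ?thesis using le[of "[(u, w), (w, v)]"] assms by (simp add: awalk_def)
    qed
  }
qed

lemma pair_graph_graph_square:
  assumes "pair_graph G"
  shows "pair_graph (graph_square G)"
proof -
  interpret pair_graph G by fact
  have "sym (parcs G)"
    using pair_sym_arcs by (auto simp: symmetric_def)
  then have dist_sym: "graph_dist G v u \<le> 2"
    if "u \<in> pverts G" "v \<in> pverts G" "graph_dist G u v \<le> 2" for u v
    using that by (auto simp only: graph_dist_le_2_iff dest: symD)
  show ?thesis
  proof
    show "finite (parcs (graph_square G))"
      by (rule finite_subset[of _ "pverts G \<times> pverts G"]) (auto simp: graph_square_def)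
    show "symmetric (graph_square G)"
      using dist_sym by (auto simp only: symmetric_def sym_def with_proj_simps graph_square_def
        pair_pre_digraph.simps mem_Collect_eq case_prod_conv)
  qed (auto simp: graph_square_def)
qed

end

theory Submission
  imports Defs
begin

text \<open>
  For \<open>n \<ge> 6\<close> all tori are coloured at once. The vertex \<open>(i, j)\<close> gets the colour \<open>f (x\<^sub>i) (y\<^sub>j)\<close>, where
  \<open>x\<close> and \<open>y\<close> are cyclic words over finite sets of row and column types. Whether this is proper only
  depends on the cyclic factors of length 3 of \<open>x\<close> and \<open>y\<close>. If \<open>x\<close> is a concatenation of words that
  all begin with the same two letters, then its factors occur already in the cyclic words of the
  single pieces. So a finite check covers all concatenations; pieces of lengths 3, 4, 5 for the rows
  and 6, ..., 11 for the columns yield all \<open>m \<ge> 3\<close> and \<open>n \<ge> 6\<close>. The lower bounds hold because independent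
  sets have at most one vertex in the square of \<open>T\<^bsub>3,3\<^esub>\<close>, and at most two for \<open>T\<^bsub>3,5\<^esub>\<close> and \<open>T\<^bsub>4,4\<^esub>\<close>.
\<close>


section \<open>Adjacency in the square of a torus\<close>

lemma pverts_torus_graph [simp]: "pverts (torus_graph m n) = {..<m} \<times> {..<n}"
  by (simp add: torus_graph_def cart_prod_def cycle_graph_def)

lemma pverts_graph_square [simp]: "pverts (graph_square G) = pverts G"
  by (simp add: graph_square_def)

text \<open>The successor in Z/m by a case distinction instead of \<open>mod\<close>, which makes it
  injective on all natural numbers.\<close>

definition next_mod :: "nat \<Rightarrow> nat \<Rightarrow> nat" where
  "next_mod m i = (if i + 1 = m then 0 else i + 1)"

lemma next_mod_eq_mod: "i < m \<Longrightarrow> next_mod m i = (i + 1) mod m"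
  by (simp add: next_mod_def)

lemma next_mod_less [simp]: "i < m \<Longrightarrow> next_mod m i < m"
  by (simp add: next_mod_def)

lemma next_mod_inj: "next_mod m i = next_mod m j \<Longrightarrow> i = j"
  by (simp add: next_mod_def split: if_splits)

text \<open>Up to sign, the nonzero vectors of l1-norm at most 2 are (1,0), (2,0), (0,1), (0,2),
  (1,1) and (1,-1). One of each opposite pair is listed, which halves the cases to be checked for a
  colouring.\<close>

definition torus_near :: "nat \<Rightarrow> nat \<Rightarrow> nat \<times> nat \<Rightarrow> nat \<times> nat \<Rightarrow> bool" where
  "torus_near m n = (\<lambda>(i, j) (i', j').
     j = j' \<and> (i' = next_mod m i \<or> i' = next_mod m (next_mod m i)) \<or>
     i = i' \<and> (j' = next_mod n j \<or> j' = next_mod n (next_mod n j)) \<or>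
     i' = next_mod m i \<and> (j' = next_mod n j \<or> j = next_mod n j'))"

lemma parcs_torus_graph:
  "((i, j), (i', j')) \<in> parcs (torus_graph m n) \<longleftrightarrow>
    i < m \<and> i' < m \<and> j < n \<and> j' < n \<and>
    (i = i' \<and> (j' = next_mod n j \<or> j = next_mod n j') \<or>
     j = j' \<and> (i' = next_mod m i \<or> i = next_mod m i'))"
  by (auto simp: torus_graph_def cart_prod_def cycle_graph_def next_mod_eq_mod)

lemma parcs_square_torus:
  assumes "3 \<le> m" "3 \<le> n"
  shows "(u, v) \<in> parcs (graph_square (torus_graph m n)) \<longleftrightarrow>
    u \<in> {..<m} \<times> {..<n} \<and> v \<in> {..<m} \<times> {..<n} \<and> u \<noteq> v \<and>
    (torus_near m n u v \<or> torus_near m n v u)" (is "?L \<longleftrightarrow> ?R")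
proof -
  interpret pair_graph "torus_graph m n"
    by (rule pair_graph_torus_graph) fact+
  obtain i j i' j' where uv: "u = (i, j)" "v = (i', j')"
    by fastforce
  show ?thesis
  proof (cases "u \<in> pverts (torus_graph m n) \<and> v \<in> pverts (torus_graph m n) \<and> u \<noteq> v")
    case False
    then show ?thesis
      by (auto simp: graph_square_def)
  next
    case True
    then have *: "i < m" "j < n" "i' < m" "j' < n" "(i, j) \<noteq> (i', j')"
      by (auto simp: uv)
    have "?L \<longleftrightarrow> (u, v) \<in> parcs (torus_graph m n) \<or>
        (\<exists>w. (u, w) \<in> parcs (torus_graph m n) \<and> (w, v) \<in> parcs (torus_graph m n))" (is "_ \<longleftrightarrow> ?A")
      using True unfolding graph_square_def
      by (simp only: pair_pre_digraph.simps mem_Collect_eq case_prod_conv graph_dist_le_2_iff)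
        simp
    also have "\<dots> \<longleftrightarrow> torus_near m n u v \<or> torus_near m n v u"
    proof
      \<comment> \<open>Two opposite steps in one cycle lead back to \<open>u\<close> because
        \<open>next_mod\<close> is injective, against \<open>u \<noteq> v\<close>; all other walks
        of length at most two give a listed offset up to sign.\<close>
      assume ?A
      then show "torus_near m n u v \<or> torus_near m n v u"
        using * by (auto simp: uv parcs_torus_graph torus_near_def dest: next_mod_inj)
    next
      assume "torus_near m n u v \<or> torus_near m n v u"
      then show ?A
        using * by (auto simp: uv parcs_torus_graph torus_near_def intro: next_mod_less)
    qed
    finally show ?thesis
      using True by simp
  qed
qed

section \<open>Chromatic number and independent sets\<close>

lemma ex_proper_colouring_chromatic_number:
  assumes "pair_graph G"
  shows "\<exists>c. proper_colouring G (chromatic_number G) c"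
proof -
  interpret pair_graph G by fact
  show ?thesis
    unfolding chromatic_number_def by (rule LeastI) (rule ex_proper_colouring)
qed

lemma chromatic_number_le: "proper_colouring G k c \<Longrightarrow> chromatic_number G \<le> k"
  unfolding chromatic_number_def by (blast intro: Least_le)

text \<open>The colour classes of an optimal colouring are independent and cover all vertices, and
  each accounts for at most \<open>a\<close> of them.\<close>

lemma card_le_chromatic_number:
  assumes "pair_graph G"
    and "\<And>S. S \<subseteq> pverts G \<Longrightarrow> \<forall>u\<in>S. \<forall>v\<in>S. (u, v) \<notin> parcs G \<Longrightarrow> card S \<le> a"
  shows "card (pverts G) \<le> chromatic_number G * a"
proof -
  obtain c where c: "proper_colouring G (chromatic_number G) c"
    using ex_proper_colouring_chromatic_number[OF assms(1)] by blast
  define C where "C i = {v \<in> pverts G. c v = i}" for i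
  have "pverts G = (\<Union>i<chromatic_number G. C i)"
    using c by (auto simp: C_def proper_colouring_def)
  then have "card (pverts G) \<le> (\<Sum>i<chromatic_number G. card (C i))"
    by (metis card_UN_le finite_lessThan)
  also have "\<dots> \<le> (\<Sum>i<chromatic_number G. a)"
    using c by (intro sum_mono assms(2)) (auto simp: C_def proper_colouring_def)
  finally show ?thesis
    by simp
qed

section \<open>Factors of length 3 of cyclic words\<close>

fun windows :: "'a list \<Rightarrow> ('a \<times> 'a \<times> 'a) list" where
  "windows (x # y # z # xs) = (x, y, z) # windows (y # z # xs)"
| "windows xs = []"

lemma nth_windows:
  "i + 2 < length xs \<Longrightarrow> (xs ! i, xs ! (i + 1), xs ! (i + 2)) \<in> set (windows xs)"
proof (induction xs arbitrary: i rule: windows.induct)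
  case (1 x y z xs)
  then show ?case
    by (cases i) auto
qed auto

text \<open>A factor that starts in \<open>xs\<close> reaches at most two letters into
  \<open>ys\<close>.\<close>

lemma windows_append:
  assumes "2 \<le> length ys"
  shows "set (windows (xs @ ys)) \<subseteq> set (windows (xs @ take 2 ys)) \<union> set (windows ys)"
proof (induction xs rule: windows.induct)
  case (1 x y z xs)
  then show ?case
    by auto
next
  case ("2_3" x y)
  obtain a b zs where "ys = a # b # zs"
    using assms by (metis One_nat_def Suc_1 Suc_le_length_iff)
  then show ?case
    by auto
next
  case ("2_2" x)
  obtain a b zs where "ys = a # b # zs"
    using assms by (metis One_nat_def Suc_1 Suc_le_length_iff)
  then show ?case
    by auto
qed auto

lemma take_concat_append:
  assumes "length p = 2" "\<forall>w\<in>set ws. take 2 w = p" "take 2 ys = p"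
  shows "take 2 (concat ws @ ys) = p"
proof (cases ws)
  case (Cons w ws')
  then have "take 2 w = p" "2 \<le> length w"
    using assms(1,2) by auto
  then show ?thesis
    using Cons by simp
qed (use assms in simp)

text \<open>Every piece is followed by \<open>p\<close>, as the beginning of the next piece or as
  the final \<open>p\<close>. So a factor starting in \<open>w\<close> already occurs in
  \<open>w @ p\<close>.\<close>

lemma windows_concat:
  assumes "length p = 2" "\<forall>w\<in>set ws. take 2 w = p"
  shows "set (windows (concat ws @ p)) \<subseteq> (\<Union>w\<in>set ws. set (windows (w @ p)))"
  using assms(2)
proof (induction ws)
  case Nil
  then show ?case
    using assms(1) by (auto simp: length_Suc_conv numeral_2_eq_2)
next
  case (Cons w ws)
  have *: "take 2 (concat ws @ p) = p"
    using Cons.prems assms(1) by (intro take_concat_append) auto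
  show ?case
    using windows_append[of "concat ws @ p" w, unfolded *] Cons assms(1) by auto
qed

lemma nth_cyclic_windows:
  assumes "take 2 xs = p" "length p = 2" "i < length xs"
  defines "n \<equiv> length xs"
  shows "(xs ! i, xs ! next_mod n i, xs ! next_mod n (next_mod n i)) \<in> set (windows (xs @ p))"
proof -
  have "2 \<le> n"
    using assms by auto
  \<comment> \<open>The positions \<open>n\<close> and \<open>n + 1\<close> repeat the positions 0
    and 1, and a factor starting at \<open>i < n\<close> reaches no further.\<close>
  have *: "(xs @ p) ! j = xs ! (j mod n)" if "j < n + 2" for j
  proof (cases "j < n")
    case False
    then have "j mod n = j - n" "j - n < 2"
      using that \<open>2 \<le> n\<close> by (auto simp: mod_if)
    then show ?thesis
      using False assms(1) by (auto simp: nth_append n_def)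
  qed (auto simp: nth_append n_def)
  have next2: "next_mod n (next_mod n i) = (i + 2) mod n"
    using assms(3) next_mod_less[of i n] by (simp add: next_mod_eq_mod mod_Suc_eq n_def)
  show ?thesis
    using nth_windows[of i "xs @ p"] assms *[of i] *[of "i + 1"] *[of "i + 2"] unfolding next2
    by (simp add: next_mod_eq_mod)
qed

section \<open>Colourings of tori from pairs of words\<close>

text \<open>In the block with rows \<open>a\<close>, \<open>b\<close>, \<open>c\<close> and columns
  \<open>d\<close>, \<open>e\<close>, \<open>g\<close>, the set lists the offsets (1,0), (2,0),
  (0,1), (0,2), (1,1) from the corner, in this order. The offset (1,-1) leads out of the block, so
  it is tested from \<open>(a, e)\<close> to \<open>(b, d)\<close>.\<close>

definition separated ::
    "nat \<Rightarrow> ('a \<Rightarrow> 'b \<Rightarrow> nat) \<Rightarrow> 'a \<times> 'a \<times> 'a \<Rightarrow> 'b \<times> 'b \<times> 'b \<Rightarrow> bool" where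
  "separated k f = (\<lambda>(a, b, c) (d, e, g).
     f a d < k \<and> f a d \<notin> {f b d, f c d, f a e, f a g, f b e} \<and> f a e \<noteq> f b d)"

lemma chromatic_number_square_torus_le:
  assumes "length xs = m" "length ys = n" "3 \<le> m" "3 \<le> n"
    and sep: "\<forall>s\<in>set (windows (xs @ take 2 xs)).
      \<forall>t\<in>set (windows (ys @ take 2 ys)). separated k f s t"
  shows "chromatic_number (graph_square (torus_graph m n)) \<le> k"
proof (rule chromatic_number_le)
  let ?c = "\<lambda>(i, j). f (xs ! i) (ys ! j)"
  have len: "length (take 2 xs) = 2" "length (take 2 ys) = 2"
    using assms(1-4) by auto
  have sep': "separated k f (xs ! i, xs ! next_mod m i, xs ! next_mod m (next_mod m i))
      (ys ! j, ys ! next_mod n j, ys ! next_mod n (next_mod n j))"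
    if "i < m" "j < n" for i j
    using sep nth_cyclic_windows[OF refl len(1), of i] nth_cyclic_windows[OF refl len(2), of j]
      that assms(1,2) by blast
  have "?c u \<noteq> ?c v" if "torus_near m n u v" "u \<in> {..<m} \<times> {..<n}" "v \<in> {..<m} \<times> {..<n}" for u v
  proof -
    obtain i j i' j' where [simp]: "u = (i, j)" "v = (i', j')"
      by fastforce
    have *: "i < m" "j < n" "i' < m" "j' < n"
      using that by auto
    \<comment> \<open>The block at \<open>(i, j)\<close> settles five offsets; for (1,-1), where
      \<open>j\<close> follows \<open>j'\<close>, the block at \<open>(i, j')\<close> is
      used.\<close>
    show ?thesis
      using that(1) sep'[OF *(1,2)] sep'[OF *(1,4)] by (auto simp: torus_near_def separated_def)
  qed
  then have "?c u \<noteq> ?c v" if "(u, v) \<in> parcs (graph_square (torus_graph m n))" for u v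
    using that unfolding parcs_square_torus[OF assms(3,4)] by metis
  moreover have "?c v < k" if "v \<in> {..<m} \<times> {..<n}" for v
    using that sep' by (auto simp: separated_def)
  ultimately show "proper_colouring (graph_square (torus_graph m n)) k ?c"
    unfolding proper_colouring_def by auto
qed

text \<open>Splitting off pieces of length \<open>k\<close> ends with a length in
  \<open>{k..<2 * k}\<close>, which is a single piece.\<close>

lemma ex_concat_length:
  assumes "0 < k" "{k..<2 * k} \<subseteq> length ` set W" "k \<le> n"
  shows "\<exists>ws. set ws \<subseteq> set W \<and> length (concat ws) = n"
  using assms(3)
proof (induction n rule: less_induct)
  case (less n)
  show ?case
  proof (cases "n < 2 * k")
    case True
    then obtain w where "w \<in> set W" "length w = n"
      using less.prems assms(2) by fastforce
    then show ?thesis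
      by (intro exI[of _ "[w]"]) auto
  next
    case False
    then obtain ws where ws: "set ws \<subseteq> set W" "length (concat ws) = n - k"
      using less.IH[of "n - k"] less.prems assms(1) by fastforce
    obtain w where "w \<in> set W" "length w = k"
      using assms(1,2) by fastforce
    then show ?thesis
      using ws False by (intro exI[of _ "w # ws"]) auto
  qed
qed

text \<open>Written with lists instead of set intervals so that \<open>code_simp\<close> can
  evaluate it.\<close>

definition cyclic_words :: "nat \<Rightarrow> 'a list \<Rightarrow> 'a list list \<Rightarrow> bool" where
  "cyclic_words k p W \<longleftrightarrow>
    length p = 2 \<and> (\<forall>w\<in>set W. take 2 w = p) \<and> set [k..<2 * k] \<subseteq> set (map length W)"

lemma ex_cyclic_word:
  assumes "cyclic_words k p W" "0 < k" "k \<le> n"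
  obtains xs where "length xs = n"
    "set (windows (xs @ take 2 xs)) \<subseteq> set (concat (map (\<lambda>w. windows (w @ p)) W))"
proof -
  obtain ws where ws: "set ws \<subseteq> set W" "length (concat ws) = n"
    using ex_concat_length[OF assms(2) _ assms(3), of W] assms(1) by (auto simp: cyclic_words_def)
  have *: "length p = 2" "\<forall>w\<in>set ws. take 2 w = p"
    using assms(1) ws(1) by (auto simp: cyclic_words_def)
  \<comment> \<open>As \<open>n > 0\<close>, there is a first piece; the word then begins with
    \<open>p\<close>, so closing it cyclically means appending \<open>p\<close>.\<close>
  obtain w ws' where "ws = w # ws'"
    using ws(2) assms(2,3) by (cases ws) auto
  moreover have "2 \<le> length w" if "w \<in> set ws" for w
    using * that by auto
  ultimately have "take 2 (concat ws) = p"
    using * by auto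
  then show ?thesis
    using ws windows_concat[OF *] by (intro that[of "concat ws"]) fastforce+
qed

lemma chromatic_number_square_torus_le_words:
  assumes "cyclic_words k p V" "cyclic_words l q W" "3 \<le> k" "3 \<le> l" "k \<le> m" "l \<le> n"
    and "\<forall>s\<in>set (concat (map (\<lambda>w. windows (w @ p)) V)).
         \<forall>t\<in>set (concat (map (\<lambda>w. windows (w @ q)) W)). separated r f s t"
  shows "chromatic_number (graph_square (torus_graph m n)) \<le> r"
proof -
  obtain xs where "length xs = m"
    "set (windows (xs @ take 2 xs)) \<subseteq> set (concat (map (\<lambda>w. windows (w @ p)) V))"
    using ex_cyclic_word[OF assms(1) _ assms(5)] assms(3) by auto
  moreover obtain ys where "length ys = n"
    "set (windows (ys @ take 2 ys)) \<subseteq> set (concat (map (\<lambda>w. windows (w @ q)) W))"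
    using ex_cyclic_word[OF assms(2) _ assms(6)] assms(4) by auto
  ultimately show ?thesis
    using chromatic_number_square_torus_le[of xs m ys n r f] assms(3-7) by (meson le_trans subsetD)
qed

text \<open>
  The six row types are numbered and a column type is the list of the colours it has in each row
  type. The words were found with a SAT solver.
\<close>

lemma chromatic_number_square_torus_le_7:
  assumes "3 \<le> m" "6 \<le> n"
  shows "chromatic_number (graph_square (torus_graph m n)) \<le> 7"
proof (rule chromatic_number_square_torus_le_words)
  let ?V = "[[0, 1, 2], [0, 1, 3, 4], [0, 1, 3, 5, 4]] :: nat list list"
  let ?W = "map ((@) [[0,2,6,3,4,1], [1,4,3,6,5,0], [6,5,0,2,3,4]])
   [[[4,3,1,1,0,6], [5,6,2,4,2,3], [3,1,4,0,6,5]],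
    [[2,3,4,1,0,5], [5,0,1,4,6,2], [4,6,2,5,1,3], [3,1,5,0,2,6]],
    [[2,3,4,0,1,6], [0,1,6,4,5,2], [4,2,5,3,6,0], [3,6,0,5,1,4], [5,1,4,0,2,6]],
    [[2,3,4,1,0,5], [5,0,1,4,6,2], [4,2,6,5,3,0], [0,3,5,1,2,6], [1,6,2,4,5,3], [3,5,4,0,6,2]],
    [[4,3,1,1,0,6], [5,6,2,4,2,3], [3,1,4,0,6,5], [0,5,6,2,4,1], [2,3,1,6,5,0], [6,0,4,4,1,3],
     [3,1,5,5,2,6]],
    [[4,3,1,0,1,5], [0,6,5,4,2,3], [3,1,2,5,6,0], [5,4,0,3,1,2], [6,2,1,0,4,5], [0,3,5,1,2,6],
     [1,6,2,4,5,3], [3,5,4,0,6,2]]] :: nat list list list"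
  let ?p = "[0, 1] :: nat list" and ?q = "[[0,2,6,3,4,1], [1,4,3,6,5,0]] :: nat list list"
  show "cyclic_words 3 ?p ?V"
    by code_simp
  show "cyclic_words 6 ?q ?W"
    by code_simp
  show "\<forall>s\<in>set (concat (map (\<lambda>w. windows (w @ ?p)) ?V)).
    \<forall>t\<in>set (concat (map (\<lambda>w. windows (w @ ?q)) ?W)). separated 7 (\<lambda>i c. c ! i) s t"
    by code_simp
qed (use assms in auto)

section \<open>Lower bounds from independent sets\<close>

definition torus_far :: "nat \<Rightarrow> nat \<Rightarrow> nat \<times> nat \<Rightarrow> nat \<times> nat \<Rightarrow> bool" where
  "torus_far m n u v \<longleftrightarrow> u \<noteq> v \<and> \<not> torus_near m n u v \<and> \<not> torus_near m n v u"

lemma mult_le_chromatic_number_square_torus: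
  assumes "3 \<le> m" "3 \<le> n"
    and "\<And>S. S \<subseteq> {..<m} \<times> {..<n} \<Longrightarrow> pairwise (torus_far m n) S \<Longrightarrow> card S \<le> a"
  shows "m * n \<le> chromatic_number (graph_square (torus_graph m n)) * a"
proof -
  let ?G = "graph_square (torus_graph m n)"
  have "card (pverts ?G) \<le> chromatic_number ?G * a"
  proof (rule card_le_chromatic_number)
    show "pair_graph ?G"
      using assms(1,2) by (intro pair_graph_graph_square pair_graph_torus_graph)
    fix S assume S: "S \<subseteq> pverts ?G" "\<forall>u\<in>S. \<forall>v\<in>S. (u, v) \<notin> parcs ?G"
    have "torus_far m n u v" if "u \<in> S" "v \<in> S" "u \<noteq> v" for u v
      using that S parcs_square_torus[OF assms(1,2), of u v] by (auto simp: torus_far_def)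
    then show "card S \<le> a"
      using S(1) by (intro assms(3)) (auto simp: pairwise_def)
  qed
  then show ?thesis
    by simp
qed

text \<open>The finite check says that the graph of non-adjacent pairs has no triangle, so colour
  classes have at most two vertices.\<close>

lemma chromatic_number_square_torus_ge_half:
  assumes "3 \<le> m" "3 \<le> n"
    and "\<forall>u\<in>set (List.product [0..<m] [0..<n]). \<forall>v\<in>set (List.product [0..<m] [0..<n]).
      torus_far m n u v \<longrightarrow>
        (\<forall>w\<in>set (List.product [0..<m] [0..<n]). \<not> (torus_far m n u w \<and> torus_far m n v w))"
  shows "m * n \<le> chromatic_number (graph_square (torus_graph m n)) * 2"
proof (rule mult_le_chromatic_number_square_torus[OF assms(1,2)])
  fix S assume S: "S \<subseteq> {..<m} \<times> {..<n}" "pairwise (torus_far m n) S"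
  show "card S \<le> 2"
  proof (rule ccontr)
    assume "\<not> card S \<le> 2"
    then obtain T where "T \<subseteq> S" "card T = 3"
      using obtain_subset_with_card_n[of 3 S] by auto
    then obtain u v w where uvw: "u \<in> S" "v \<in> S" "w \<in> S" "u \<noteq> v" "u \<noteq> w" "v \<noteq> w"
      by (auto simp: card_3_iff)
    then have "torus_far m n u v" "torus_far m n u w" "torus_far m n v w"
      using S(2) by (auto dest: pairwiseD)
    moreover have "S \<subseteq> set (List.product [0..<m] [0..<n])"
      using S(1) by auto
    ultimately show False
      using assms(3) uvw(1-3) by (meson subsetD)
  qed
qed

section \<open>Tori with both cycles of length at most 5\<close>

lemma chromatic_number_square_torus_3_3: "chromatic_number (graph_square (torus_graph 3 3)) = 9"
proof (rule antisym)
  let ?G = "graph_square (torus_graph 3 3)"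
  interpret pair_graph ?G
    by (intro pair_graph_graph_square pair_graph_torus_graph) auto
  show "chromatic_number ?G \<le> 9"
    using ex_proper_colouring chromatic_number_le by fastforce
  \<comment> \<open>Any two vertices are at distance at most 2, so the square is the complete graph
    on nine vertices.\<close>
  have far: "\<forall>u\<in>set (List.product [0..<3] [0..<3]). \<forall>v\<in>set (List.product [0..<3] [0..<3]).
      \<not> torus_far 3 3 u v"
    by code_simp
  have "3 * 3 \<le> chromatic_number ?G * 1"
  proof (rule mult_le_chromatic_number_square_torus)
    fix S :: "(nat \<times> nat) set" assume S: "S \<subseteq> {..<3} \<times> {..<3}" "pairwise (torus_far 3 3) S"
    then have "S \<subseteq> set (List.product [0..<3] [0..<3])"
      by auto
    then have "u = v" if "u \<in> S" "v \<in> S" for u v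
      using far pairwiseD[OF S(2) that] that by (meson subsetD)
    then show "card S \<le> 1"
      using finite_subset[OF S(1)] by (auto simp: card_le_Suc0_iff_eq)
  qed auto
  then show "9 \<le> chromatic_number ?G"
    by simp
qed

lemma chromatic_number_square_torus_3_5: "chromatic_number (graph_square (torus_graph 3 5)) = 8"
proof (rule antisym)
  \<comment> \<open>Each row is its own type, so the entries of \<open>?ys\<close> are the columns
    of the colouring.\<close>
  let ?xs = "[0, 1, 2] :: nat list"
  let ?ys = "[[0,2,3], [1,7,6], [4,5,0], [7,3,2], [6,4,1]] :: nat list list"
  have "\<forall>s\<in>set (windows (?xs @ take 2 ?xs)). \<forall>t\<in>set (windows (?ys @ take 2 ?ys)).
      separated 8 (\<lambda>i c. c ! i) s t"
    by code_simp
  then show "chromatic_number (graph_square (torus_graph 3 5)) \<le> 8"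
    by (rule chromatic_number_square_torus_le[rotated 4]) simp_all
  \<comment> \<open>Fifteen vertices in classes of at most two: 15 / 2 rounds up to 8.\<close>
  have "3 * 5 \<le> chromatic_number (graph_square (torus_graph 3 5)) * 2"
    by (rule chromatic_number_square_torus_ge_half) (simp, simp, code_simp)
  then show "8 \<le> chromatic_number (graph_square (torus_graph 3 5))"
    by simp
qed

lemma chromatic_number_square_torus_4_4: "chromatic_number (graph_square (torus_graph 4 4)) = 8"
proof (rule antisym)
  let ?xs = "[0, 1, 2, 3] :: nat list"
  let ?ys = "[[0,2,7,5], [1,5,6,3], [6,7,4,0], [4,3,1,2]] :: nat list list"
  have "\<forall>s\<in>set (windows (?xs @ take 2 ?xs)). \<forall>t\<in>set (windows (?ys @ take 2 ?ys)).
      separated 8 (\<lambda>i c. c ! i) s t"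
    by code_simp
  then show "chromatic_number (graph_square (torus_graph 4 4)) \<le> 8"
    by (rule chromatic_number_square_torus_le[rotated 4]) simp_all
  \<comment> \<open>The count 16 / 2 = 8 is met exactly: in the colouring above each colour occurs
    twice.\<close>
  have "4 * 4 \<le> chromatic_number (graph_square (torus_graph 4 4)) * 2"
    by (rule chromatic_number_square_torus_ge_half) (simp, simp, code_simp)
  then show "8 \<le> chromatic_number (graph_square (torus_graph 4 4))"
    by simp
qed

text \<open>With the three exceptional tori, these are all pairs \<open>3 \<le> m \<le> n\<close>
  with \<open>n \<le> 5\<close>.\<close>

lemma chromatic_number_square_torus_small_le_7:
  shows "chromatic_number (graph_square (torus_graph 3 4)) \<le> 7"
    and "chromatic_number (graph_square (torus_graph 4 5)) \<le> 7"
    and "chromatic_number (graph_square (torus_graph 5 5)) \<le> 7"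
proof -
  let ?sep = "\<lambda>xs ys. \<forall>s\<in>set (windows (xs @ take 2 xs)). \<forall>t\<in>set (windows (ys @ take 2 ys)).
    separated 7 (\<lambda>i c. c ! i) s t"
  have "?sep [0, 1, 2] [[0,2,4], [1,5,3], [4,0,2], [3,6,1]]"
    by code_simp
  then show "chromatic_number (graph_square (torus_graph 3 4)) \<le> 7"
    by (rule chromatic_number_square_torus_le[rotated 4]) simp_all
  have "?sep [0, 1, 2, 3] [[0,2,1,5], [1,4,6,3], [2,3,5,0], [5,0,4,1], [4,6,3,2]]"
    by code_simp
  then show "chromatic_number (graph_square (torus_graph 4 5)) \<le> 7"
    by (rule chromatic_number_square_torus_le[rotated 4]) simp_all
  \<comment> \<open>This is the linear colouring \<open>(2 * i + j) mod 5\<close>, with only five of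
    the seven colours.\<close>
  have "?sep [0, 1, 2, 3, 4] [[0,2,4,1,3], [1,3,0,2,4], [2,4,1,3,0], [3,0,2,4,1], [4,1,3,0,2]]"
    by code_simp
  then show "chromatic_number (graph_square (torus_graph 5 5)) \<le> 7"
    by (rule chromatic_number_square_torus_le[rotated 4]) simp_all
qed

theorem theorem3:
  shows "(\<forall>m n :: nat. 3 \<le> m \<and> m \<le> n \<and> (m, n) \<notin> {(3, 3), (3, 5), (4, 4)} \<longrightarrow>
            chromatic_number (graph_square (torus_graph m n)) \<le> 7) \<and>
         chromatic_number (graph_square (torus_graph 3 3)) = 9 \<and>
         chromatic_number (graph_square (torus_graph 3 5)) = 8 \<and>
         chromatic_number (graph_square (torus_graph 4 4)) = 8"
proof (intro conjI allI impI)
  fix m n :: nat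
  assume *: "3 \<le> m \<and> m \<le> n \<and> (m, n) \<notin> {(3, 3), (3, 5), (4, 4)}"
  show "chromatic_number (graph_square (torus_graph m n)) \<le> 7"
  proof (cases "6 \<le> n")
    case True
    then show ?thesis
      using * by (intro chromatic_number_square_torus_le_7) auto
  next
    case False
    then have "m \<in> {3, 4, 5}" "n \<in> {3, 4, 5}"
      using * by auto
    then show ?thesis
      using * chromatic_number_square_torus_small_le_7 by auto
  qed
qed (fact chromatic_number_square_torus_3_3 chromatic_number_square_torus_3_5
  chromatic_number_square_torus_4_4)+

end
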